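(* Let $\mathcal{A}$ be a unital complex algebra, $\psi,\varphi:\mathcal{A}\to\mathbb{C}$ unital linear functionals, $\omega:\mathcal{A}\to\mathbb{C}$ a tracial linear functional, and let $x,y\in\mathcal{A}$ be cyclically conditionally free relatively to $(\psi,\varphi,\omega)$, with $\psi(x)\ne0$ and $\psi(y)\neq0$. Let $\tilde W_x=(\eta^\psi_x)^{\langle-1\rangle}\circ\eta^\psi_{xy}$ and $\tilde W_y=(\eta^\psi_y)^{\langle-1\rangle}\circ\eta^\psi_{xy}$. Then, as formal power series, $$\begin{aligned}M^\omega_{xy}(z)=\;&z\frac{\tilde W_x'(z)}{\tilde W_x(z)}M^\omega_x(\tilde W_x(z))+z\frac{\tilde W_y'(z)}{\tilde W_y(z)}M^\omega_y(\tilde W_y(z))\\&-z\frac{d}{dz}\ln\!\left(\frac{1-\eta^\varphi_{xy}(z)}{(1-\eta^\varphi_x(\tilde W_x(z)))(1-\eta^\varphi_y(\tilde W_y(z)))}\right)-(1-\omega(1_{\mathcal{A}}))\,z\frac{d}{dz}\ln\!\big(1-\eta^\psi_{xy}(z)\big).\end{aligned}$$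
   Context: For a linear functional $\theta\in\{\psi,\varphi,\omega\}$ and $x\in\mathcal{A}$: $M^\theta_x(z)=\sum_{n\ge1}\theta(x^n)z^n$; for $\theta\in\{\psi,\varphi\}$: $\eta^\theta_x(z)=\frac{M^\theta_x(z)}{1+M^\theta_x(z)}$. All are formal power series in $z$ without constant term; $(\cdot)^{\langle-1\rangle}$ is the compositional inverse, so $\tilde W_x$ is the formal power series without constant term with $\eta^\psi_x(\tilde W_x(z))=\eta^\psi_{xy}(z)$, and similarly $\tilde W_y$. Primes are formal derivatives. Elements $x,y$ are cyclically conditionally free relatively to $(\psi,\varphi,\omega)$ if the unital subalgebras $\mathcal{A}_1,\mathcal{A}_2$ they generate are, meaning: for all $c_k\in\mathcal{A}_{j_k}$, $1\le k\le n$, with $\psi(c_k)=0$ for all $k$ and $j_k\ne j_{k+1}$ for $1\le k\le n-1$, one has $\psi(c_1\cdots c_n)=0$ and $\varphi(c_1\cdots c_n)=\varphi(c_1)\cdots\varphi(c_n)$; and if moreover $n\ge2$ and $j_n\neq j_1$, then $\omega(c_1\cdots c_n)=\varphi(c_1)\cdots\varphi(c_n)$. *)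

theory Defs
  imports Complex_Main "HOL-Computational_Algebra.Formal_Power_Series"
begin

text \<open>The library has the class \<open>real_algebra_1\<close> but no complex analogue, so the scalar
  multiplication is an explicit parameter.  The algebra is the whole type \<open>'a\<close>; that class
  \<open>ring_1\<close> excludes \<open>0 = 1\<close> costs nothing, as a zero algebra has no unital functional.\<close>

locale complex_algebra_1 = vector_space scale
  for scale :: "complex \<Rightarrow> 'a::ring_1 \<Rightarrow> 'a" +
  assumes scale_mult_left: "scale r a * b = scale r (a * b)"
    and scale_mult_right: "a * scale r b = scale r (a * b)"

definition linear_functional ::
  "(complex \<Rightarrow> 'a \<Rightarrow> 'a) \<Rightarrow> ('a::ring_1 \<Rightarrow> complex) \<Rightarrow> bool" where
  "linear_functional scale f \<longleftrightarrow> Vector_Spaces.linear scale (*) f"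

definition unital_linear_functional ::
  "(complex \<Rightarrow> 'a \<Rightarrow> 'a) \<Rightarrow> ('a::ring_1 \<Rightarrow> complex) \<Rightarrow> bool" where
  "unital_linear_functional scale f \<longleftrightarrow> linear_functional scale f \<and> f 1 = 1"

definition tracial_linear_functional ::
  "(complex \<Rightarrow> 'a \<Rightarrow> 'a) \<Rightarrow> ('a::ring_1 \<Rightarrow> complex) \<Rightarrow> bool" where
  "tracial_linear_functional scale f \<longleftrightarrow>
     linear_functional scale f \<and> (\<forall>a b. f (a * b) = f (b * a))"

definition unital_subalgebra :: "(complex \<Rightarrow> 'a \<Rightarrow> 'a) \<Rightarrow> 'a::ring_1 set \<Rightarrow> bool" where
  "unital_subalgebra scale S \<longleftrightarrow>
     module.subspace scale S \<and> 1 \<in> S \<and> (\<forall>a\<in>S. \<forall>b\<in>S. a * b \<in> S)"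

text \<open>The list \<open>map c [1..<Suc n]\<close> is \<open>[c 1, \<dots>, c n]\<close>, so the \<open>prod_list\<close> below is the ordered
  product \<open>c 1 * \<dots> * c n\<close>.\<close>

definition cyclically_cond_free_subalgebras ::
  "'a::ring_1 set \<Rightarrow> 'a set \<Rightarrow>
   ('a \<Rightarrow> complex) \<Rightarrow> ('a \<Rightarrow> complex) \<Rightarrow> ('a \<Rightarrow> complex) \<Rightarrow> bool" where
  "cyclically_cond_free_subalgebras A\<^sub>1 A\<^sub>2 \<psi> \<phi> \<omega> \<longleftrightarrow>
     (\<forall>(n::nat) (j :: nat \<Rightarrow> nat) (c :: nat \<Rightarrow> 'a).
        1 \<le> n \<longrightarrow>
        (\<forall>k\<in>{1..n}. j k \<in> {1, 2} \<and> c k \<in> (if j k = 1 then A\<^sub>1 else A\<^sub>2) \<and> \<psi> (c k) = 0) \<longrightarrow>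
        (\<forall>k. 1 \<le> k \<and> k < n \<longrightarrow> j k \<noteq> j (Suc k)) \<longrightarrow>
          \<psi> (prod_list (map c [1..<Suc n])) = 0 \<and>
          \<phi> (prod_list (map c [1..<Suc n])) = (\<Prod>k=1..n. \<phi> (c k)) \<and>
          (2 \<le> n \<and> j n \<noteq> j 1 \<longrightarrow>
             \<omega> (prod_list (map c [1..<Suc n])) = (\<Prod>k=1..n. \<phi> (c k))))"

definition cyclically_cond_free ::
  "(complex \<Rightarrow> 'a \<Rightarrow> 'a) \<Rightarrow> 'a::ring_1 \<Rightarrow> 'a \<Rightarrow>
   ('a \<Rightarrow> complex) \<Rightarrow> ('a \<Rightarrow> complex) \<Rightarrow> ('a \<Rightarrow> complex) \<Rightarrow> bool" where
  "cyclically_cond_free scale x y \<psi> \<phi> \<omega> \<longleftrightarrow>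
     cyclically_cond_free_subalgebras
       (unital_subalgebra scale hull {x}) (unital_subalgebra scale hull {y}) \<psi> \<phi> \<omega>"

definition moment_series :: "('a::ring_1 \<Rightarrow> complex) \<Rightarrow> 'a \<Rightarrow> complex fps" where
  "moment_series \<theta> x = Abs_fps (\<lambda>n. if n = 0 then 0 else \<theta> (x ^ n))"

definition eta_series :: "('a::ring_1 \<Rightarrow> complex) \<Rightarrow> 'a \<Rightarrow> complex fps" where
  "eta_series \<theta> x = moment_series \<theta> x / (1 + moment_series \<theta> x)"

text \<open>The formal logarithm of a series with constant term 1: \<open>fps_ln 1\<close> is the series of
  \<open>ln (1 + z)\<close>.\<close>

definition fps_log :: "complex fps \<Rightarrow> complex fps" where
  "fps_log F = fps_ln 1 oo (F - 1)"

text \<open>The series \<open>z W'(z) / W(z)\<close>.  Division of formal power series in the library is exact only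
  when the denominator divides the numerator.  For a nonzero series \<open>W\<close> without constant term,
  \<open>W\<close> divides \<open>z W'\<close>, but it does not divide \<open>W'\<close>; hence the factor \<open>z\<close> has to be inside the
  numerator.\<close>

definition z_log_deriv :: "complex fps \<Rightarrow> complex fps" where
  "z_log_deriv W = (fps_X * fps_deriv W) / W"

end

theory Submission
  imports Defs
begin

text \<open>
  Let \<open>w\<close> be the formal variable, \<open>u\<close> and \<open>v\<close> the compositional inverses of \<open>\<eta>\<^sup>\<psi>\<^sub>x\<close> and
  \<open>\<eta>\<^sup>\<psi>\<^sub>y\<close>, and \<open>Z = u v / w\<close>.  In the algebra of power series in \<open>w\<close> with coefficients in \<open>\<A>\<close>,
  the resolvents \<open>(1 - w) (1 - u x)\<^sup>-\<^sup>1 = 1 + w a\<close> and \<open>(1 - w) (1 - v y)\<^sup>-\<^sup>1 = 1 + w b\<close> have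
  \<open>\<psi>\<close>-centred \<open>a\<close>, \<open>b\<close>, and
  \<open>1 - Z x y = (1 - u x) (1 - w a b) (1 - v y) (1 - w)\<^sup>-\<^sup>1\<close>.

  Inverting this and expanding \<open>(1 - w a b)\<^sup>-\<^sup>1\<close> as a geometric series of alternating centred words,
  \<open>\<psi>\<close> gives \<open>\<eta>\<^sup>\<psi>\<^sub>x\<^sub>y(Z(w)) = w\<close>, and \<open>\<phi>\<close> gives \<open>\<eta>\<^sup>\<phi>\<^sub>x\<^sub>y(Z)\<close> in terms of
  \<open>\<tau> = w \<phi>(a) \<phi>(b)\<close>.  By traciality the logarithmic derivative \<open>P \<mapsto> \<omega>(P' P\<^sup>-\<^sup>1)\<close> is additive
  on products; the three resolvent factors produce the three moment series of \<open>\<omega>\<close>, and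
  \<open>1 - w a b\<close> contributes \<open>- \<tau>' / (1 - \<tau>)\<close> by cyclic conditional freeness.  Substituting
  \<open>w = \<eta>\<^sup>\<psi>\<^sub>x\<^sub>y(z)\<close> yields the formula.
\<close>

unbundle fps_syntax

section \<open>Coefficientwise functionals and alternating words\<close>

definition fps_map :: "('b \<Rightarrow> 'c) \<Rightarrow> 'b fps \<Rightarrow> 'c fps" where
  "fps_map \<theta> F = Abs_fps (\<lambda>n. \<theta> (F $ n))"

lemma fps_map_nth [simp]: "fps_map \<theta> F $ n = \<theta> (F $ n)"
  by (simp add: fps_map_def)

text \<open>Words are lists, not products, so that one pattern describes both the letters of a word
  and the sets to which these letters belong, as in \<open>alternating S S' n\<close>.\<close>

fun alternating :: "'b \<Rightarrow> 'b \<Rightarrow> nat \<Rightarrow> 'b list" where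
  "alternating a b 0 = []"
| "alternating a b (Suc n) = a # alternating b a n"

lemma length_alternating [simp]: "length (alternating a b n) = n"
  by (induction n arbitrary: a b) auto

lemma nth_alternating: "i < n \<Longrightarrow> alternating a b n ! i = (if even i then a else b)"
  by (induction n arbitrary: a b i) (auto simp: nth_Cons')

lemma list_all2_alternating:
  "P a S \<Longrightarrow> P b S' \<Longrightarrow> list_all2 P (alternating a b n) (alternating S S' n)"
  by (induction n arbitrary: a b S S') auto

lemma map_alternating: "map f (alternating a b n) = alternating (f a) (f b) n"
  by (induction n arbitrary: a b) auto

lemma prod_list_alternating_even:
  fixes a b :: "'b::monoid_mult"
  shows "prod_list (alternating a b (2 * k)) = (a * b) ^ k"
  by (induction k) (auto simp: mult.assoc)

lemma prod_list_alternating_odd: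
  fixes a b :: "'b::monoid_mult"
  shows "prod_list (alternating a b (Suc (2 * k))) = (a * b) ^ k * a"
  by (induction k) (auto simp: mult.assoc)

section \<open>Power series over a noncommutative ring\<close>

text \<open>Multiplication by \<open>fps_X\<close> only shifts coefficients, so it can be cancelled
  even when the ring has zero divisors.\<close>

lemma fps_X_left_cancel:
  fixes F G :: "'b::ring_1 fps"
  assumes "fps_X * F = fps_X * G"
  shows "F = G"
proof (rule fps_ext)
  fix n
  have "(fps_X * F) $ Suc n = (fps_X * G) $ Suc n" using assms by simp
  then show "F $ n = G $ n" by simp
qed

lemma fps_X_power_left_commute:
  fixes F G :: "'b::ring_1 fps"
  shows "F * (fps_X ^ k * G) = fps_X ^ k * (F * G)"
proof -
  have "F * (fps_X ^ k * G) = F * fps_X ^ k * G"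
    by (simp only: mult.assoc)
  also have "\<dots> = fps_X ^ k * F * G"
    by (simp only: fps_mult_fps_X_power_commute[of k F])
  finally show ?thesis by (simp only: mult.assoc)
qed

lemma fps_X_left_commute:
  fixes F G :: "'b::ring_1 fps"
  shows "F * (fps_X * G) = fps_X * (F * G)"
  using fps_X_power_left_commute[of F 1 G] by simp

lemma fps_X_mult_power:
  fixes F :: "'b::ring_1 fps"
  shows "(fps_X * F) ^ k = fps_X ^ k * F ^ k"
proof (induction k)
  case (Suc k)
  have "(fps_X * F) ^ Suc k = fps_X * (F * (fps_X ^ k * F ^ k))"
    by (simp only: power_Suc Suc mult.assoc)
  then show ?case
    by (simp only: fps_X_power_left_commute[of F] power_Suc mult.assoc)
qed simp

text \<open>\<open>T\<close> is \<open>fps_X\<close> times a series and \<open>fps_X\<close> is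
  central, so a factor \<open>fps_X ^ k\<close> can be pulled out in front.\<close>

lemma fps_X_power_mult_nth_zero:
  fixes C D T :: "'b::ring_1 fps"
  assumes "T $ 0 = 0" "n < k"
  shows "(C * T ^ k * D) $ n = 0"
proof -
  define G where "G = fps_shift 1 T"
  have T: "T = fps_X * G"
    using assms(1) by (intro fps_ext) (auto simp: G_def)
  have "C * T ^ k * D = fps_X ^ k * (C * (G ^ k * D))"
    by (simp only: T fps_X_mult_power mult.assoc fps_X_power_left_commute[of C])
  then show ?thesis using assms(2) by (simp add: fps_X_power_mult_nth)
qed

text \<open>The geometric series is kept finite with an explicit remainder, so that no convergence
  argument is required; a right inverse \<open>R\<close> suffices for the telescoping.\<close>

lemma inverse_geometric_expansion:
  fixes R T :: "'b::ring_1"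
  assumes "(1 - T) * R = 1"
  shows "R = (\<Sum>k=0..n. T ^ k) + T ^ Suc n * R"
proof (induction n)
  case 0
  show ?case using assms by (simp add: algebra_simps)
next
  case (Suc n)
  have "T ^ Suc n * R = T ^ Suc n * ((1 - T) * R + T * R)"
    by (simp add: algebra_simps)
  also have "\<dots> = T ^ Suc n + T ^ Suc (Suc n) * R"
    by (simp add: assms distrib_left mult.assoc[symmetric] power_Suc2 del: power_Suc)
  finally show ?case using Suc by (simp add: add.assoc)
qed

lemma fps_two_sided_inverse:
  fixes F :: "'b::ring_1 fps"
  assumes "F $ 0 = 1"
  obtains G where "F * G = 1" "G * F = 1"
  using fps_right_inverse[of F 1] fps_left_inverse[of 1 F]
    fps_left_inverse_eq_fps_right_inverse[of 1 F 1] assms that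
  by (metis mult_1_right)

section \<open>Additive functionals on geometric series and on products\<close>

lemma additive_sum:
  assumes "\<And>a b. \<theta> (a + b) = \<theta> a + (\<theta> b :: complex)"
  shows "\<theta> (sum f I) = (\<Sum>i\<in>I. \<theta> (f i :: 'b::ring_1))"
proof -
  have "\<theta> 0 = 0" using assms[of 0 0] by simp
  then show ?thesis
    by (induction I rule: infinite_finite_induct) (auto simp: assms)
qed

text \<open>The remainder contains \<open>T ^ Suc n\<close> and therefore does not reach the
  coefficient of degree \<open>n\<close>.\<close>

lemma inverse_power_expansion_nth:
  fixes C D R T :: "'b::ring_1 fps"
  assumes \<theta>: "\<And>a b. \<theta> (a + b) = \<theta> a + (\<theta> b :: complex)"
    and T: "T $ 0 = 0" and R: "(1 - T) * R = 1"
  shows "fps_map \<theta> (C * R * D) $ n = (\<Sum>k=0..n. fps_map \<theta> (C * T ^ k * D) $ n)"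
proof -
  have "C * R * D = C * ((\<Sum>k=0..n. T ^ k) + T ^ Suc n * R) * D"
    using inverse_geometric_expansion[OF R, of n] by (rule arg_cong)
  also have "\<dots> = (\<Sum>k=0..n. C * T ^ k * D) + C * T ^ Suc n * (R * D)"
    by (simp add: distrib_left distrib_right sum_distrib_left sum_distrib_right mult.assoc)
  finally have "(C * R * D) $ n = (\<Sum>k=0..n. (C * T ^ k * D) $ n)"
    using fps_X_power_mult_nth_zero[OF T, of n "Suc n" C "R * D"] by (simp add: fps_sum_nth del: power_Suc)
  then show ?thesis by (simp add: additive_sum[of \<theta>, OF \<theta>])
qed

text \<open>If a functional sends the powers of \<open>T\<close>, placed between \<open>C\<close>
  and \<open>D\<close>, to a scalar geometric progression, it sends the resolvent of
  \<open>T\<close> to the scalar resolvent. Both sides are expanded and compared coefficient by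
  coefficient.\<close>

lemma fps_map_inverse_geometric:
  fixes C D R T :: "'b::ring_1 fps"
  assumes \<theta>: "\<And>a b. \<theta> (a + b) = \<theta> a + (\<theta> b :: complex)"
    and T: "T $ 0 = 0" and R: "(1 - T) * R = 1" and \<tau>: "\<tau> $ 0 = 0"
    and powers: "\<And>k. fps_map \<theta> (C * T ^ k * D) = \<tau> ^ k * c"
  shows "fps_map \<theta> (C * R * D) = inverse (1 - \<tau>) * c"
proof (rule fps_ext)
  fix n
  have inv: "(1 - \<tau>) * inverse (1 - \<tau>) = 1"
    using \<tau> by (intro inverse_mult_eq_1') auto
  have "\<theta> ((C * T ^ k * D) $ n) = (\<tau> ^ k * c) $ n" for k
    using powers by (metis fps_map_nth)
  then show "fps_map \<theta> (C * R * D) $ n = (inverse (1 - \<tau>) * c) $ n"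
    \<comment> \<open>The scalar side is the same expansion, taken for the identity functional on
      the complex numbers.\<close>
    using inverse_power_expansion_nth[of \<theta> T R C D n, OF \<theta> T R]
      inverse_power_expansion_nth[of "\<lambda>a. a" \<tau> "inverse (1 - \<tau>)" 1 c n] \<tau> inv
    by simp
qed

text \<open>Each coefficient of the product is a sum of words whose letters are coefficients of the
  factors, so multiplicativity on words over \<open>Ss\<close> passes to series. A separate
  \<open>t\<close> appears because \<open>\<omega>\<close> of a word is a product of values of
  \<open>\<phi>\<close>.\<close>

lemma fps_map_prod_list:
  fixes \<theta> t :: "'b::ring_1 \<Rightarrow> complex"
  assumes \<theta>: "\<And>a b. \<theta> (a + b) = \<theta> a + \<theta> b"
    and mult: "\<And>cs. list_all2 (\<in>) cs Ss \<Longrightarrow> \<theta> (prod_list cs) = prod_list (map t cs)"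
    and Fs: "list_all2 (\<lambda>F S. \<forall>n. F $ n \<in> S) Fs Ss"
  shows "fps_map \<theta> (prod_list Fs) = prod_list (map (fps_map t) Fs)"
proof -
  \<comment> \<open>The hypothesis speaks of complete words only. The induction therefore carries a
    prefix \<open>cs\<close> of coefficients already chosen from earlier factors.\<close>
  have gen: "fps_map \<theta> (fps_const (prod_list cs) * prod_list Fs) =
      fps_const (prod_list (map t cs)) * prod_list (map (fps_map t) Fs)"
    if "list_all2 (\<in>) cs Us" "list_all2 (\<lambda>F S. \<forall>n. F $ n \<in> S) Fs Vs" "Us @ Vs = Ss"
    for cs Us Vs
    using that(2,1,3)
  proof (induction Fs Vs arbitrary: cs Us rule: list_all2_induct)
    case Nil
    have "\<theta> 0 = 0" using \<theta>[of 0 0] by simp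
    with Nil show ?case using mult[of cs] by (intro fps_ext) auto
  next
    case (Cons F Fs S Vs)
    show ?case
    proof (rule fps_ext)
      fix n
      have step: "\<theta> (prod_list cs * F $ i * prod_list Fs $ m) =
          prod_list (map t cs) * t (F $ i) * prod_list (map (fps_map t) Fs) $ m" for i m
      proof -
        have "fps_map \<theta> (fps_const (prod_list (cs @ [F $ i])) * prod_list Fs) $ m =
           (fps_const (prod_list (map t (cs @ [F $ i]))) * prod_list (map (fps_map t) Fs)) $ m"
          using Cons.IH[of "cs @ [F $ i]" "Us @ [S]"] Cons.prems Cons.hyps
          by (simp add: list_all2_appendI)
        then show ?thesis by (simp add: mult.assoc)
      qed
      have "fps_map \<theta> (fps_const (prod_list cs) * F * prod_list Fs) $ n =
        (fps_const (prod_list (map t cs)) * fps_map t F * prod_list (map (fps_map t) Fs)) $ n"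
        unfolding fps_map_nth fps_mult_nth[of _ _ n] additive_sum[of \<theta>, OF \<theta>]
        by (simp add: step)
      then show "fps_map \<theta> (fps_const (prod_list cs) * prod_list (F # Fs)) $ n =
        (fps_const (prod_list (map t cs)) * prod_list (map (fps_map t) (F # Fs))) $ n"
        by (simp only: mult.assoc prod_list.Cons list.map)
    qed
  qed
  show ?thesis using gen[of "[]" "[]" Ss] Fs by simp
qed

section \<open>Consequences of cyclic conditional freeness\<close>

lemma cyclically_cond_free_subalgebras_commute:
  assumes "cyclically_cond_free_subalgebras A B \<psi> \<phi> \<omega>"
  shows "cyclically_cond_free_subalgebras B A \<psi> \<phi> \<omega>"
  unfolding cyclically_cond_free_subalgebras_def
proof (intro allI impI)
  fix n :: nat and j :: "nat \<Rightarrow> nat" and c :: "nat \<Rightarrow> 'a"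
  assume n: "1 \<le> n"
    and j: "\<forall>k\<in>{1..n}. j k \<in> {1, 2} \<and> c k \<in> (if j k = 1 then B else A) \<and> \<psi> (c k) = 0"
    and alt: "\<forall>k. 1 \<le> k \<and> k < n \<longrightarrow> j k \<noteq> j (Suc k)"
  define j' where "j' k = 3 - j k" for k
  have j': "\<forall>k\<in>{1..n}. j' k \<in> {1, 2} \<and> c k \<in> (if j' k = 1 then A else B) \<and> \<psi> (c k) = 0"
    using j by (auto simp: j'_def)
  have flip: "j' k \<noteq> j' l \<longleftrightarrow> j k \<noteq> j l" if "k \<in> {1..n}" "l \<in> {1..n}" for k l
  proof -
    have "j k \<in> {1, 2}" "j l \<in> {1, 2}" using j that by blast+
    then show ?thesis by (auto simp: j'_def)
  qed
  have alt': "\<forall>k. 1 \<le> k \<and> k < n \<longrightarrow> j' k \<noteq> j' (Suc k)"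
    using alt by (auto simp: flip)
  have cyc: "j' n \<noteq> j' 1 \<longleftrightarrow> j n \<noteq> j 1" using n by (intro flip) auto
  show "\<psi> (prod_list (map c [1..<Suc n])) = 0 \<and>
          \<phi> (prod_list (map c [1..<Suc n])) = (\<Prod>k=1..n. \<phi> (c k)) \<and>
          (2 \<le> n \<and> j n \<noteq> j 1 \<longrightarrow>
             \<omega> (prod_list (map c [1..<Suc n])) = (\<Prod>k=1..n. \<phi> (c k)))"
    using assms[unfolded cyclically_cond_free_subalgebras_def, rule_format, OF n, of j' c]
      j' alt' cyc by blast
qed

text \<open>A word that starts in \<open>A\<close> ends in the other algebra exactly when its length
  is even, which is the condition on the first and last letters in the clause for
  \<open>\<omega>\<close>.\<close>

lemma alternating_word_values:
  assumes free: "cyclically_cond_free_subalgebras A B \<psi> \<phi> \<omega>"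
    and cs: "list_all2 (\<in>) cs (alternating {c \<in> A. \<psi> c = 0} {c \<in> B. \<psi> c = 0} n)"
    and n: "1 \<le> n"
  shows "\<psi> (prod_list cs) = 0"
    and "\<phi> (prod_list cs) = prod_list (map \<phi> cs)"
    and "even n \<Longrightarrow> \<omega> (prod_list cs) = prod_list (map \<phi> cs)"
proof -
  \<comment> \<open>Letters are numbered from 1 in the definition of freeness and from 0 in a list,
    so the odd positions carry the letters of \<open>A\<close>.\<close>
  define c where "c k = cs ! (k - 1)" for k
  define j :: "nat \<Rightarrow> nat" where "j k = (if odd k then 1 else 2)" for k
  have len: "length cs = n" using cs list_all2_lengthD by fastforce
  have word: "map c [1..<Suc n] = cs"
    by (rule nth_equalityI) (auto simp: len c_def simp del: upt_Suc)
  have mem: "cs ! i \<in> (if even i then A else B) \<and> \<psi> (cs ! i) = 0" if "i < n" for i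
    using list_all2_nthD2[OF cs, of i] that by (auto simp: nth_alternating split: if_splits)
  have prod: "(\<Prod>k=1..n. \<phi> (c k)) = prod_list (map \<phi> cs)"
  proof -
    have "(\<Prod>k=1..n. \<phi> (c k)) = prod_list (map (\<lambda>k. \<phi> (c k)) [1..<Suc n])"
      by (simp only: prod.distinct_set_conv_list[symmetric] distinct_upt set_upt atLeastLessThanSuc_atLeastAtMost)
    also have "map (\<lambda>k. \<phi> (c k)) [1..<Suc n] = map \<phi> cs"
      by (subst word[symmetric]) (simp del: upt_Suc)
    finally show ?thesis .
  qed
  have j: "\<forall>k\<in>{1..n}. j k \<in> {1, 2} \<and> c k \<in> (if j k = 1 then A else B) \<and> \<psi> (c k) = 0"
  proof
    fix k assume k: "k \<in> {1..n}"
    then show "j k \<in> {1, 2} \<and> c k \<in> (if j k = 1 then A else B) \<and> \<psi> (c k) = 0"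
      using mem[of "k - 1"] by (cases k) (auto simp: j_def c_def split: if_splits)
  qed
  have alt: "\<forall>k. 1 \<le> k \<and> k < n \<longrightarrow> j k \<noteq> j (Suc k)" by (auto simp: j_def)
  have "\<psi> (prod_list cs) = 0 \<and> \<phi> (prod_list cs) = prod_list (map \<phi> cs) \<and>
     (2 \<le> n \<and> j n \<noteq> j 1 \<longrightarrow> \<omega> (prod_list cs) = prod_list (map \<phi> cs))"
    using free[unfolded cyclically_cond_free_subalgebras_def, rule_format, OF n, of j c] j alt
    unfolding word prod by blast
  then show "\<psi> (prod_list cs) = 0"
    and "\<phi> (prod_list cs) = prod_list (map \<phi> cs)"
    and "even n \<Longrightarrow> \<omega> (prod_list cs) = prod_list (map \<phi> cs)"
    using n by (auto simp: j_def)
qed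

lemma linear_functionalD:
  assumes "linear_functional scale \<theta>"
  shows "\<theta> (a + b) = \<theta> a + \<theta> b" "\<theta> (scale r a) = r * \<theta> a" "\<theta> 0 = 0" "\<theta> (- a) = - \<theta> a"
    "\<theta> (a - b) = \<theta> a - \<theta> b"
proof -
  interpret Vector_Spaces.linear scale "(*)" \<theta>
    using assms unfolding linear_functional_def .
  show "\<theta> (a + b) = \<theta> a + \<theta> b" "\<theta> (scale r a) = r * \<theta> a" "\<theta> 0 = 0" "\<theta> (- a) = - \<theta> a"
    "\<theta> (a - b) = \<theta> a - \<theta> b"
    by (simp_all add: add scale neg diff)
qed

section \<open>Scalar series inside the series over the algebra\<close>

context complex_algebra_1
begin

text \<open>Embeds scalar series as central elements, so that
  \<open>1 - fps_scalar u * fps_const x\<close> is the series \<open>1 - u x\<close>.\<close>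

definition fps_scalar :: "complex fps \<Rightarrow> 'a fps" where
  "fps_scalar f = fps_map (\<lambda>c. scale c 1) f"

lemma fps_scalar_nth [simp]: "fps_scalar f $ n = scale (f $ n) 1"
  by (simp add: fps_scalar_def)

lemma fps_scalar_mult_nth: "(fps_scalar f * F) $ n = (\<Sum>i=0..n. scale (f $ i) (F $ (n - i)))"
  by (simp add: fps_mult_nth scale_mult_left)

lemma fps_scalar_commute: "fps_scalar f * F = F * fps_scalar f"
proof (rule fps_ext)
  fix n
  have "(F * fps_scalar f) $ n = (\<Sum>i=0..n. scale (f $ (n - i)) (F $ i))"
    by (simp add: fps_mult_nth scale_mult_right)
  also have "\<dots> = (\<Sum>i=0..n. scale (f $ i) (F $ (n - i)))"
    by (rule sum.reindex_bij_witness[of _ "\<lambda>i. n - i" "\<lambda>i. n - i"]) auto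
  finally show "(fps_scalar f * F) $ n = (F * fps_scalar f) $ n"
    by (simp add: fps_scalar_mult_nth)
qed

lemma fps_scalar_commute_left: "F * (fps_scalar f * G) = fps_scalar f * (F * G)"
  by (metis fps_scalar_commute mult.assoc)

lemma fps_scalar_simps [simp]:
  "fps_scalar 0 = 0" "fps_scalar 1 = 1" "fps_scalar fps_X = fps_X"
  by (auto intro!: fps_ext simp: fps_X_def)

lemma fps_scalar_diff: "fps_scalar (f - g) = fps_scalar f - fps_scalar g"
  by (auto intro!: fps_ext simp: scale_left_diff_distrib)

lemma fps_scalar_mult: "fps_scalar (f * g) = fps_scalar f * fps_scalar g"
  by (rule fps_ext) (simp add: fps_mult_nth scale_mult_left scale_sum_left)

lemma fps_scalar_power: "fps_scalar (f ^ n) = fps_scalar f ^ n"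
  by (induction n) (auto simp: fps_scalar_mult)

lemma of_nat_mult_eq_scale: "of_nat m * a = scale (of_nat m) a"
  by (induction m) (auto simp: scale_left_distrib distrib_right)

lemma fps_scalar_deriv: "fps_deriv (fps_scalar f) = fps_scalar (fps_deriv f)"
  by (rule fps_ext) (simp add: of_nat_mult_eq_scale del: of_nat_Suc)

end

section \<open>Linear functionals on series and resolvents\<close>

locale complex_functional = complex_algebra_1 +
  fixes \<theta> :: "'a \<Rightarrow> complex"
  assumes lin: "linear_functional scale \<theta>"
begin

lemmas theta_simps = linear_functionalD[OF lin]

lemma fps_map_add: "fps_map \<theta> (F + G) = fps_map \<theta> F + fps_map \<theta> G"
  and fps_map_diff: "fps_map \<theta> (F - G) = fps_map \<theta> F - fps_map \<theta> G"
  and fps_map_minus: "fps_map \<theta> (- F) = - fps_map \<theta> F"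
  and fps_map_const: "fps_map \<theta> (fps_const a) = fps_const (\<theta> a)"
  and fps_map_one: "fps_map \<theta> 1 = fps_const (\<theta> 1)"
  by (auto intro!: fps_ext simp: theta_simps)

lemma theta_sum: "\<theta> (sum f I) = (\<Sum>i\<in>I. \<theta> (f i))"
  by (rule additive_sum) (rule theta_simps)

lemma fps_map_scalar_mult: "fps_map \<theta> (fps_scalar f * F) = f * fps_map \<theta> F"
  by (rule fps_ext) (simp add: fps_mult_nth scale_mult_left theta_sum theta_simps)

lemma fps_map_X_mult: "fps_map \<theta> (fps_X * F) = fps_X * fps_map \<theta> F"
  using fps_map_scalar_mult[of fps_X] by simp

lemma fps_map_deriv: "fps_map \<theta> (fps_deriv F) = fps_deriv (fps_map \<theta> F)"
  by (rule fps_ext) (simp add: of_nat_mult_eq_scale theta_simps del: of_nat_Suc)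

lemma fps_map_mult_commute:
  assumes "\<And>a b. \<theta> (a * b) = \<theta> (b * a)"
  shows "fps_map \<theta> (F * G) = fps_map \<theta> (G * F)"
proof (rule fps_ext)
  fix n
  have "\<theta> ((F * G) $ n) = (\<Sum>i=0..n. \<theta> (G $ (n - i) * F $ i))"
    by (simp add: fps_mult_nth theta_sum assms)
  also have "\<dots> = (\<Sum>i=0..n. \<theta> (G $ i * F $ (n - i)))"
    by (rule sum.reindex_bij_witness[of _ "\<lambda>i. n - i" "\<lambda>i. n - i"]) auto
  finally show "fps_map \<theta> (F * G) $ n = fps_map \<theta> (G * F) $ n"
    by (simp add: fps_mult_nth theta_sum)
qed

text \<open>\<open>E\<close> is the geometric series of \<open>u x\<close>. The term of degree 0,
  which \<open>moment_series\<close> omits, returns as \<open>\<theta> 1\<close>; it stays explicit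
  because \<open>\<omega>\<close> is not assumed unital.\<close>

lemma fps_map_resolvent:
  assumes u: "u $ 0 = 0" and E: "(1 - fps_scalar u * fps_const x) * E = 1"
  shows "fps_map \<theta> E = fps_const (\<theta> 1) + (moment_series \<theta> x oo u)"
proof (rule fps_ext)
  fix n
  have power: "(fps_scalar u * fps_const x) ^ k = fps_scalar (u ^ k) * fps_const (x ^ k)" for k
  proof (induction k)
    case (Suc k)
    have "(fps_scalar u * fps_const x) ^ Suc k
        = fps_scalar u * (fps_const x * (fps_scalar (u ^ k) * fps_const (x ^ k)))"
      by (simp add: Suc mult.assoc)
    also have "\<dots> = fps_scalar (u ^ Suc k) * fps_const (x ^ Suc k)"
      unfolding fps_scalar_commute_left[of "fps_const x"]
      by (simp add: fps_scalar_mult mult.assoc fps_const_mult)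
    finally show ?case .
  qed simp
  have "fps_map \<theta> (1 * E * 1) $ n = (\<Sum>k=0..n. fps_map \<theta> (1 * (fps_scalar u * fps_const x) ^ k * 1) $ n)"
    using E u by (intro inverse_power_expansion_nth) (auto simp: theta_simps)
  also have "\<dots> = (\<Sum>k=0..n. \<theta> (x ^ k) * (u ^ k) $ n)"
    by (simp only: mult_1_left mult_1_right power fps_map_scalar_mult fps_map_const) (simp add: mult.commute)
  also have "\<dots> = (\<Sum>k=0..n. (if k = 0 then \<theta> 1 * (if n = 0 then 1 else 0) else 0)
      + moment_series \<theta> x $ k * (u ^ k) $ n)"
    by (intro sum.cong) (auto simp: moment_series_def)
  also have "\<dots> = (fps_const (\<theta> 1) + (moment_series \<theta> x oo u)) $ n"
    by (simp add: sum.distrib fps_compose_nth)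
  finally show "fps_map \<theta> E $ n = (fps_const (\<theta> 1) + (moment_series \<theta> x oo u)) $ n" by simp
qed

end

section \<open>The eta series as an inverse\<close>

lemma one_minus_eta: "1 - eta_series \<theta> x = inverse (1 + moment_series \<theta> x)"
proof -
  define M where "M = moment_series \<theta> x"
  have nz: "(1 + M) $ 0 \<noteq> 0" by (simp add: M_def moment_series_def)
  have "eta_series \<theta> x = ((1 + M) - 1) * inverse (1 + M)"
    using nz by (simp add: eta_series_def M_def[symmetric] fps_divide_unit)
  also have "\<dots> = 1 - inverse (1 + M)"
    using inverse_mult_eq_1'[OF nz] by (simp only: left_diff_distrib mult_1_left)
  finally show ?thesis by (simp add: M_def)
qed

lemma one_minus_eta_compose:
  assumes "u $ 0 = 0"
  shows "1 - (eta_series \<theta> x oo u) = inverse (1 + (moment_series \<theta> x oo u))"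
proof -
  have "1 - (eta_series \<theta> x oo u) = (1 - eta_series \<theta> x) oo u"
    by (simp add: fps_compose_sub_distrib)
  also have "\<dots> = inverse (1 + moment_series \<theta> x) oo u"
    by (simp only: one_minus_eta)
  also have "\<dots> = inverse ((1 + moment_series \<theta> x) oo u)"
    using assms by (intro fps_inverse_compose) (auto simp: moment_series_def)
  finally show ?thesis by (simp add: fps_compose_add_distrib)
qed

section \<open>Centred resolvents and the factorization of \<open>1 - Z x y\<close>\<close>

context complex_algebra_1
begin

lemma unital_subalgebra_hull: "unital_subalgebra scale (unital_subalgebra scale hull S)"
proof (rule hull_in)
  fix T assume T: "Ball T (unital_subalgebra scale)"
  have "subspace (\<Inter>T)" using T by (intro subspace_Inter) (auto simp: unital_subalgebra_def)
  then show "unital_subalgebra scale (\<Inter>T)"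
    using T unfolding unital_subalgebra_def by blast
qed

text \<open>Strong induction along \<open>E = 1 + u x E\<close>: as \<open>u\<close> has no constant
  term, coefficient \<open>n\<close> of the right side involves only earlier coefficients of
  \<open>E\<close>.\<close>

lemma resolvent_in_subalgebra:
  assumes A: "unital_subalgebra scale A" "x \<in> A" and u: "u $ 0 = 0"
    and E: "(1 - fps_scalar u * fps_const x) * E = 1"
  shows "E $ n \<in> A"
proof (induction n rule: less_induct)
  case (less n)
  have sub: "subspace A" and one: "1 \<in> A" and mult: "\<And>a b. a \<in> A \<Longrightarrow> b \<in> A \<Longrightarrow> a * b \<in> A"
    using A(1) by (auto simp: unital_subalgebra_def)
  have "E = 1 + fps_scalar u * (fps_const x * E)"
    using E by (simp add: algebra_simps)
  from arg_cong[OF this, of "\<lambda>F. F $ n"]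
  have "E $ n = (if n = 0 then 1 else 0) + (\<Sum>i=0..n. scale (u $ i) (x * E $ (n - i)))"
    by (simp only: fps_add_nth fps_one_nth fps_scalar_mult_nth fps_mult_left_const_nth)
  also have "(\<Sum>i=0..n. scale (u $ i) (x * E $ (n - i))) \<in> A"
  proof (rule subspace_sum[OF sub])
    fix i assume "i \<in> {0..n}"
    show "scale (u $ i) (x * E $ (n - i)) \<in> A"
    proof (cases "i = 0")
      case True
      then show ?thesis using u subspace_0[OF sub] by simp
    next
      case False
      with \<open>i \<in> {0..n}\<close> have "E $ (n - i) \<in> A" by (intro less) auto
      then show ?thesis by (intro subspace_scale[OF sub] mult A(2))
    qed
  qed
  then have "(if n = 0 then 1 else 0) + (\<Sum>i=0..n. scale (u $ i) (x * E $ (n - i))) \<in> A"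
    using one subspace_0[OF sub] by (intro subspace_add[OF sub]) auto
  finally show ?case .
qed

text \<open>With \<open>u\<close> inverse to the eta series of \<open>\<psi>\<close>, the value of
  \<open>\<psi>\<close> on \<open>E\<close> is \<open>1 / (1 - fps_X)\<close>. Hence
  \<open>(1 - fps_X) E - 1\<close> has centred coefficients.\<close>

lemma centred_resolvent:
  assumes \<psi>: "unital_linear_functional scale \<psi>"
    and A: "unital_subalgebra scale A" "x \<in> A" and u: "u $ 0 = 0"
    and eta: "eta_series \<psi> x oo u = fps_X"
  obtains E a where "(1 - fps_scalar u * fps_const x) * E = 1"
    "E * (1 - fps_scalar u * fps_const x) = 1"
    "fps_scalar (1 - fps_X) * E = 1 + fps_X * a"
    "\<And>n. a $ n \<in> {c \<in> A. \<psi> c = 0}"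
proof -
  interpret psi: complex_functional scale \<psi>
    using \<psi> by unfold_locales (auto simp: unital_linear_functional_def)
  obtain E where E: "(1 - fps_scalar u * fps_const x) * E = 1" "E * (1 - fps_scalar u * fps_const x) = 1"
    using fps_two_sided_inverse[of "1 - fps_scalar u * fps_const x"] u by auto
  define B where "B = fps_scalar (1 - fps_X) * E - 1"
  have E0: "E $ 0 = 1"
    using arg_cong[OF E(1), of "\<lambda>F. F $ 0"] u by simp
  have B0: "B $ 0 = 0" by (simp add: B_def E0)
  have sub: "subspace A" and one: "1 \<in> A" using A(1) by (auto simp: unital_subalgebra_def)
  have EA: "E $ n \<in> A" for n by (rule resolvent_in_subalgebra[OF A u E(1)])
  have BA: "B $ n \<in> A" for n
    unfolding B_def
    by (cases n) (auto simp: fps_scalar_diff left_diff_distrib E0 subspace_0[OF sub] subspace_diff[OF sub EA EA])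
  have unit: "\<psi> 1 = 1" using \<psi> by (simp add: unital_linear_functional_def)
  have "inverse (1 + (moment_series \<psi> x oo u)) = 1 - fps_X"
    using one_minus_eta_compose[OF u, of \<psi> x] eta by simp
  then have "1 + (moment_series \<psi> x oo u) = inverse (1 - fps_X)"
    using fps_inverse_idempotent[of "1 + (moment_series \<psi> x oo u)"]
    by (simp add: moment_series_def)
  then have "fps_map \<psi> E = inverse (1 - fps_X)"
    using psi.fps_map_resolvent[OF u E(1)] unit by simp
  then have "fps_map \<psi> B = 0"
    by (simp add: B_def psi.fps_map_diff psi.fps_map_scalar_mult psi.fps_map_one unit inverse_mult_eq_1')
  then have B\<psi>: "\<psi> (B $ n) = 0" for n
    by (metis fps_map_nth fps_zero_nth)
  have "fps_scalar (1 - fps_X) * E = 1 + B" by (simp add: B_def)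
  \<comment> \<open>Division by \<open>fps_X\<close> is an exact shift because \<open>B\<close> has
    no constant term; the coefficients stay in \<open>A\<close> and stay centred.\<close>
  also have "B = fps_X * fps_shift 1 B"
    using B0 by (intro fps_ext) auto
  finally show ?thesis using E BA B\<psi> by (intro that[of E "fps_shift 1 B"]) auto
qed

text \<open>Multiplied by \<open>w\<close> (that is, \<open>fps_X\<close>), the term \<open>Z x y\<close> becomes \<open>(u x) (v y)\<close>, and \<open>u x\<close>, \<open>v y\<close>
  are expressed through the resolvents.\<close>

lemma resolvent_factorization:
  fixes u v Z :: "complex fps" and x y :: 'a
  defines "p \<equiv> 1 - fps_scalar u * fps_const x" and "q \<equiv> 1 - fps_scalar v * fps_const y"
  assumes p: "p * E = 1" "E * p = 1" and q: "q * F = 1" "F * q = 1"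
    and a: "fps_scalar (1 - fps_X) * E = 1 + fps_X * a"
    and b: "fps_scalar (1 - fps_X) * F = 1 + fps_X * b"
    and Z: "fps_X * Z = u * v"
  shows "1 - fps_scalar Z * fps_const (x * y) =
    p * (1 - fps_X * (a * b)) * q * fps_scalar (inverse (1 - fps_X))"
proof -
  define P where "P = 1 - fps_scalar Z * fps_const (x * y)"
  define s where "s = fps_scalar (1 - fps_X)"
  define r where "r = fps_scalar (inverse (1 - fps_X))"
  have s: "s = 1 - fps_X" by (simp add: s_def fps_scalar_diff)
  have scomm: "G * (s * H) = s * (G * H)" "G * s = s * G" for G H
    using fps_scalar_commute_left fps_scalar_commute unfolding s_def by metis+
  have rs: "r * s = 1"
    unfolding r_def s_def fps_scalar_mult[symmetric] by (simp add: inverse_mult_eq_1)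
  have Xcomm: "G * fps_X = fps_X * G" for G :: "'a fps" by (simp add: fps_mult_fps_X_commute)
  have "(1 - p) * (1 - q) = fps_scalar u * (fps_const x * (fps_scalar v * fps_const y))"
    by (simp add: p_def q_def mult.assoc)
  also have "\<dots> = fps_scalar (fps_X * Z) * fps_const (x * y)"
    unfolding fps_scalar_commute_left[of "fps_const x"] Z
    by (simp add: fps_scalar_mult mult.assoc fps_const_mult)
  finally have XP: "fps_X * P = fps_X - (1 - p) * (1 - q)"
    by (simp add: P_def fps_scalar_mult right_diff_distrib mult.assoc)
  \<comment> \<open>Multiplying \<open>P\<close> by \<open>E\<close> on the left and
    \<open>F\<close> on the right removes \<open>p\<close> and \<open>q\<close>; two factors
    \<open>s\<close> then bring in \<open>a\<close> and \<open>b\<close>.\<close>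
  have "fps_X * (E * P * F) = E * (fps_X * P) * F"
    by (simp only: mult.assoc fps_X_left_commute[of E])
  also have "\<dots> = E * fps_X * F - (E - E * p) * (F - q * F)"
    unfolding XP by (simp add: algebra_simps)
  also have "\<dots> = fps_X * (E * F) - (E - 1) * (F - 1)"
    by (simp add: p q Xcomm[of E] mult.assoc)
  finally have "s * (s * (fps_X * (E * P * F))) = s * (s * (fps_X * (E * F))) - s * (s * ((E - 1) * (F - 1)))"
    by (simp only: right_diff_distrib)
  also have "s * (s * (fps_X * (E * F))) = fps_X * ((s * E) * (s * F))"
    by (simp only: mult.assoc scomm(1)[of fps_X] scomm(1)[of E])
  also have "s * (s * ((E - 1) * (F - 1))) = (s * E - s) * (s * F - s)"
  proof -
    have "(s * E - s) * (s * F - s) = s * ((E - 1) * (s * (F - 1)))"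
      by (simp add: algebra_simps)
    then show ?thesis by (simp only: scomm(1)[of "E - 1"])
  qed
  \<comment> \<open>Since \<open>s * E - s = fps_X * (1 + a)\<close>, and likewise for
    \<open>F\<close>, the terms linear in \<open>a\<close> and \<open>b\<close> cancel and
    \<open>fps_X (1 - fps_X) (1 - fps_X a b)\<close> remains.\<close>
  also have "fps_X * ((s * E) * (s * F)) - (s * E - s) * (s * F - s)
      = s * (fps_X * (1 - fps_X * (a * b)))"
    unfolding a[folded s_def] b[folded s_def] unfolding s
    by (simp add: algebra_simps Xcomm[of a] Xcomm[of b] fps_X_left_commute[of a] fps_X_left_commute[of b])
  finally have "r * s * (s * (fps_X * (E * P * F))) = r * s * (fps_X * (1 - fps_X * (a * b)))"
    by (simp only: mult.assoc)
  then have "fps_X * (s * (E * P * F)) = fps_X * (1 - fps_X * (a * b))"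
    unfolding rs by (simp only: mult_1_left scomm(1)[of fps_X])
  then have EPF: "s * (E * P * F) = 1 - fps_X * (a * b)"
    by (rule fps_X_left_cancel)
  have "p * (1 - fps_X * (a * b)) * q * r = p * (s * (E * P * F)) * q * r"
    by (simp only: EPF)
  also have "\<dots> = s * (p * E * P * (F * q) * r)"
    by (simp only: mult.assoc scomm(1)[of p])
  also have "\<dots> = s * (P * r)" by (simp only: p q mult_1_left mult_1_right)
  also have "\<dots> = P * (r * s)"
    by (simp only: scomm(2)[of r] scomm(1)[of P, symmetric])
  finally have "p * (1 - fps_X * (a * b)) * q * r = P" by (simp add: rs)
  then show ?thesis by (simp add: P_def r_def)
qed

end

section \<open>Alternating series under functionals, and logarithmic derivatives\<close>

context complex_functional
begin

lemma fps_map_X_power_mult: "fps_map \<theta> (fps_X ^ k * F) = fps_X ^ k * fps_map \<theta> F"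
  using fps_map_scalar_mult[of "fps_X ^ k" F] by (simp add: fps_scalar_power)

lemma fps_map_alternating_word:
  assumes "\<And>cs. list_all2 (\<in>) cs (alternating S S' n) \<Longrightarrow> \<theta> (prod_list cs) = prod_list (map t cs)"
    and "\<And>n. a $ n \<in> S" "\<And>n. b $ n \<in> S'"
  shows "fps_map \<theta> (prod_list (alternating a b n)) = prod_list (alternating (fps_map t a) (fps_map t b) n)"
  unfolding map_alternating[symmetric]
proof (rule fps_map_prod_list)
  show "list_all2 (\<lambda>F S. \<forall>n. F $ n \<in> S) (alternating a b n) (alternating S S' n)"
    using assms(2,3) by (intro list_all2_alternating) auto
qed (rule theta_simps(1), rule assms(1))

text \<open>For each \<open>k\<close> the outer factors turn \<open>(a b)^k\<close> into four
  alternating words, two of which begin with \<open>b\<close>; hence one hypothesis for each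
  starting set.\<close>

lemma fps_map_alternating_resolvent:
  assumes words: "\<And>n cs. list_all2 (\<in>) cs (alternating S S' n) \<Longrightarrow> \<theta> (prod_list cs) = prod_list (map \<theta> cs)"
      "\<And>n cs. list_all2 (\<in>) cs (alternating S' S n) \<Longrightarrow> \<theta> (prod_list cs) = prod_list (map \<theta> cs)"
    and a: "\<And>n. a $ n \<in> S" and b: "\<And>n. b $ n \<in> S'"
    and R: "(1 - fps_X * (a * b)) * R = 1"
  shows "fps_map \<theta> ((1 + fps_X * b) * R * (1 + fps_X * a)) =
    inverse (1 - fps_X * (fps_map \<theta> a * fps_map \<theta> b)) *
      ((1 + fps_X * fps_map \<theta> a) * (1 + fps_X * fps_map \<theta> b))"
proof (rule fps_map_inverse_geometric[OF _ _ R])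
  fix k
  let ?\<alpha> = "fps_map \<theta> a" and ?\<beta> = "fps_map \<theta> b"
  let ?w = "(a * b) ^ k"
  have ab: "fps_map \<theta> (prod_list (alternating a b n)) = prod_list (alternating ?\<alpha> ?\<beta> n)" for n
    by (rule fps_map_alternating_word[OF _ a b]) (rule words(1))
  have ba: "fps_map \<theta> (prod_list (alternating b a n)) = prod_list (alternating ?\<beta> ?\<alpha> n)" for n
    by (rule fps_map_alternating_word[OF _ b a]) (rule words(2))
  have w: "fps_map \<theta> ?w = (?\<alpha> * ?\<beta>) ^ k"
    using ab[of "2 * k"]
    by (simp only: prod_list_alternating_even)
  have wa: "fps_map \<theta> (?w * a) = (?\<alpha> * ?\<beta>) ^ k * ?\<alpha>"
    using ab[of "Suc (2 * k)"]
    by (simp only: prod_list_alternating_odd)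
  have bw: "fps_map \<theta> (b * ?w) = ?\<beta> * (?\<alpha> * ?\<beta>) ^ k"
    using ba[of "Suc (2 * k)"]
    by (simp only: alternating.simps(2) prod_list.Cons prod_list_alternating_even)
  have bwa: "fps_map \<theta> (b * (?w * a)) = ?\<beta> * ((?\<alpha> * ?\<beta>) ^ k * ?\<alpha>)"
    using ba[of "Suc (Suc (2 * k))"]
    by (simp only: alternating.simps(2)[of b a] prod_list.Cons prod_list_alternating_odd
        alternating.simps(2)[of ?\<beta> ?\<alpha>])
  have expand: "(1 + fps_X * b) * (fps_X * (a * b)) ^ k * (1 + fps_X * a) =
      fps_X ^ k * (?w + fps_X * (b * ?w) + fps_X * (?w * a) + fps_X * (fps_X * (b * (?w * a))))"
  proof -
    have "(1 + fps_X * b) * (fps_X * (a * b)) ^ k * (1 + fps_X * a) =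
      fps_X ^ k * ((1 + fps_X * b) * ?w * (1 + fps_X * a))"
      by (simp only: fps_X_mult_power mult.assoc fps_X_power_left_commute[of "1 + fps_X * b"])
    also have "(1 + fps_X * b) * ?w * (1 + fps_X * a) =
      ?w + fps_X * (b * ?w) + fps_X * (?w * a) + fps_X * (fps_X * (b * (?w * a)))"
      by (simp only: distrib_left distrib_right mult_1_left mult_1_right mult.assoc
          fps_X_left_commute[of ?w] fps_X_left_commute[of b] add.assoc)
    finally show ?thesis .
  qed
  show "fps_map \<theta> ((1 + fps_X * b) * (fps_X * (a * b)) ^ k * (1 + fps_X * a)) =
      (fps_X * (?\<alpha> * ?\<beta>)) ^ k * ((1 + fps_X * ?\<alpha>) * (1 + fps_X * ?\<beta>))"
    by (simp only: expand fps_map_X_power_mult fps_map_X_mult fps_map_add w wa bw bwa power_mult_distrib)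
       (simp only: algebra_simps mult_1_left mult_1_right)
qed (auto simp: theta_simps)

text \<open>Differentiation scales coefficients, so derivatives of \<open>a\<close> and
  \<open>b\<close> keep their coefficients in \<open>S\<close> and \<open>S'\<close>. All words that
  occur have positive even length, where \<open>\<omega>\<close> is given by \<open>\<phi>\<close>,
  and the product rule reassembles the derivative of \<open>\<tau>\<close>.\<close>

lemma fps_map_deriv_alternating:
  assumes words: "\<And>n cs. list_all2 (\<in>) cs (alternating S S' (2 * Suc n)) \<Longrightarrow>
      \<theta> (prod_list cs) = prod_list (map \<phi> cs)"
    and \<phi>: "linear_functional scale \<phi>"
    and sub: "subspace S" "subspace S'"
    and a: "\<And>n. a $ n \<in> S" and b: "\<And>n. b $ n \<in> S'"
    and R: "(1 - fps_X * (a * b)) * R = 1"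
  defines "\<tau> \<equiv> fps_X * (fps_map \<phi> a * fps_map \<phi> b)"
  shows "fps_map \<theta> (fps_deriv (fps_X * (a * b)) * R) = inverse (1 - \<tau>) * fps_deriv \<tau>"
proof -
  interpret phi: complex_functional scale \<phi> using \<phi> by unfold_locales
  let ?\<alpha> = "fps_map \<phi> a" and ?\<beta> = "fps_map \<phi> b"
  have deriv: "fps_deriv F $ n \<in> U" if "subspace U" "\<And>n. F $ n \<in> U" for F n U
    using that by (simp add: of_nat_mult_eq_scale subspace_scale del: of_nat_Suc)
  have word: "fps_map \<theta> (c * d * (a * b) ^ k) = fps_map \<phi> c * fps_map \<phi> d * (?\<alpha> * ?\<beta>) ^ k"
    if "\<And>n. c $ n \<in> S" "\<And>n. d $ n \<in> S'" for c d k
  proof -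
    have "fps_map \<theta> (prod_list (c # d # alternating a b (2 * k))) =
        prod_list (map (fps_map \<phi>) (c # d # alternating a b (2 * k)))"
    proof (rule fps_map_prod_list[OF _ words[of _ k]])
      show "list_all2 (\<lambda>F S. \<forall>n. F $ n \<in> S) (c # d # alternating a b (2 * k)) (alternating S S' (2 * Suc k))"
        using that a b by (simp add: list_all2_alternating)
    qed (auto simp: theta_simps)
    then show ?thesis
      by (simp only: prod_list.Cons list.map map_alternating prod_list_alternating_even mult.assoc)
  qed
  have "fps_map \<theta> (fps_deriv (fps_X * (a * b)) * R * 1) = inverse (1 - \<tau>) * fps_deriv \<tau>"
  proof (rule fps_map_inverse_geometric[OF _ _ R])
    fix k
    let ?w = "(a * b) ^ k" and ?\<omega> = "(?\<alpha> * ?\<beta>) ^ k"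
    have "fps_deriv (fps_X * (a * b)) * (fps_X * (a * b)) ^ k * 1 =
      fps_X ^ k * (fps_deriv (fps_X * (a * b)) * ?w)"
      by (simp only: mult_1_right fps_X_mult_power fps_X_power_left_commute[of "fps_deriv (fps_X * (a * b))"])
    also have "fps_deriv (fps_X * (a * b)) * ?w =
        a * b * ?w + fps_X * (a * fps_deriv b * ?w + fps_deriv a * b * ?w)"
      by (simp add: algebra_simps)
    finally have expand: "fps_deriv (fps_X * (a * b)) * (fps_X * (a * b)) ^ k * 1 =
        fps_X ^ k * (a * b * ?w + fps_X * (a * fps_deriv b * ?w + fps_deriv a * b * ?w))" .
    have "fps_map \<theta> (fps_deriv (fps_X * (a * b)) * (fps_X * (a * b)) ^ k * 1) =
        fps_X ^ k * (?\<alpha> * ?\<beta> * ?\<omega> + fps_X * (?\<alpha> * fps_map \<phi> (fps_deriv b) * ?\<omega> + fps_map \<phi> (fps_deriv a) * ?\<beta> * ?\<omega>))"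
      unfolding expand fps_map_X_power_mult fps_map_add fps_map_X_mult
      by (simp only: word[OF a b] word[OF a deriv[OF sub(2) b]] word[OF deriv[OF sub(1) a] b])
    also have "\<dots> = fps_X ^ k * ?\<omega> * (?\<alpha> * ?\<beta> + fps_X * (?\<alpha> * fps_deriv ?\<beta> + fps_deriv ?\<alpha> * ?\<beta>))"
      unfolding phi.fps_map_deriv by (simp only: distrib_left distrib_right mult.assoc mult.commute mult.left_commute)
    also have "fps_X ^ k * ?\<omega> = \<tau> ^ k"
      by (simp only: \<tau>_def power_mult_distrib)
    also have "?\<alpha> * ?\<beta> + fps_X * (?\<alpha> * fps_deriv ?\<beta> + fps_deriv ?\<alpha> * ?\<beta>) = fps_deriv \<tau>"
      by (simp add: \<tau>_def)
    finally show "fps_map \<theta> (fps_deriv (fps_X * (a * b)) * (fps_X * (a * b)) ^ k * 1) = \<tau> ^ k * fps_deriv \<tau>" .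
  qed (auto simp: theta_simps \<tau>_def)
  then show ?thesis by simp
qed

text \<open>The argument \<open>Q\<close> stands for the inverse of \<open>P\<close>, since the coefficient ring has no inverse
  operation.\<close>

definition log_deriv :: "'a fps \<Rightarrow> 'a fps \<Rightarrow> complex fps" where
  "log_deriv P Q = fps_map \<theta> (fps_deriv P * Q)"

text \<open>\<open>P'\<close> and \<open>Q'\<close> are inverses, not derivatives. The product rule
  leaves the second summand conjugated by \<open>P\<close>, and traciality removes the
  conjugation.\<close>

lemma log_deriv_mult:
  assumes tr: "\<And>a b. \<theta> (a * b) = \<theta> (b * a)"
    and P: "P * P' = 1" "P' * P = 1" and Q: "Q * Q' = 1"
  shows "log_deriv (P * Q) (Q' * P') = log_deriv P P' + log_deriv Q Q'"
proof -
  have "fps_deriv (P * Q) * (Q' * P') = P * (fps_deriv Q * Q' * P') + fps_deriv P * (Q * Q') * P'"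
    by (simp add: algebra_simps)
  then have "log_deriv (P * Q) (Q' * P') = fps_map \<theta> (P * (fps_deriv Q * Q' * P')) + log_deriv P P'"
    by (simp add: log_deriv_def fps_map_add Q)
  also have "fps_map \<theta> (P * (fps_deriv Q * Q' * P')) = log_deriv Q Q'"
    unfolding log_deriv_def by (subst fps_map_mult_commute[OF tr]) (simp add: mult.assoc P)
  finally show ?thesis by simp
qed

lemma log_deriv_scalar:
  "log_deriv (fps_scalar f) (fps_scalar g) = fps_const (\<theta> 1) * (fps_deriv f * g)"
  unfolding log_deriv_def fps_scalar_deriv fps_scalar_mult[symmetric]
  using fps_map_scalar_mult[of "fps_deriv f * g" 1] by (simp add: fps_map_one mult.commute)

text \<open>Follows from \<open>u x E = E - 1\<close>. The factor \<open>u\<close> stays on the left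
  because \<open>u\<close> has no constant term and is not invertible.\<close>

lemma log_deriv_resolvent:
  assumes u: "u $ 0 = 0" and E: "(1 - fps_scalar u * fps_const x) * E = 1"
  shows "u * log_deriv (1 - fps_scalar u * fps_const x) E = - (fps_deriv u * (moment_series \<theta> x oo u))"
proof -
  have "fps_scalar u * (fps_const x * E) = E - 1"
    using E by (simp add: algebra_simps)
  then have "u * fps_map \<theta> (fps_const x * E) = fps_map \<theta> (E - 1)"
    by (metis fps_map_scalar_mult)
  also have "\<dots> = moment_series \<theta> x oo u"
    by (simp add: fps_map_diff fps_map_one fps_map_resolvent[OF u E])
  finally have M: "u * fps_map \<theta> (fps_const x * E) = moment_series \<theta> x oo u" .
  have "fps_deriv (1 - fps_scalar u * fps_const x) * E = - (fps_scalar (fps_deriv u) * (fps_const x * E))"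
    by (simp add: fps_scalar_deriv mult.assoc)
  then have "log_deriv (1 - fps_scalar u * fps_const x) E = - (fps_deriv u * fps_map \<theta> (fps_const x * E))"
    by (simp only: log_deriv_def fps_map_minus fps_map_scalar_mult)
  then show ?thesis using M by (simp add: algebra_simps)
qed

end

section \<open>Composition and logarithms of complex series\<close>

lemma eta_series_nth_0 [simp]: "eta_series \<theta> x $ 0 = 0"
  using arg_cong[OF one_minus_eta, of "\<lambda>F. F $ 0" \<theta> x] by (simp add: moment_series_def)

lemma eta_series_nth_1: "eta_series \<theta> x $ 1 = \<theta> x"
proof -
  have "eta_series \<theta> x = moment_series \<theta> x * inverse (1 + moment_series \<theta> x)"
    unfolding eta_series_def by (rule fps_divide_unit) (simp add: moment_series_def)
  then show ?thesis by (simp add: moment_series_def)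
qed

lemma fps_compose_nth_1:
  fixes f g :: "complex fps"
  assumes "g $ 0 = 0"
  shows "(f oo g) $ 1 = f $ 1 * g $ 1"
  using assms by (simp add: fps_compose_nth)

text \<open>The linear coefficients multiply to 1, so \<open>Z\<close> has a two-sided compositional
  inverse, which must be \<open>h\<close>.\<close>

lemma fps_compose_inverse_commute:
  fixes h Z :: "complex fps"
  assumes "h $ 0 = 0" "Z $ 0 = 0" "h oo Z = fps_X"
  shows "Z oo h = fps_X"
proof -
  have "h $ 1 * Z $ 1 = 1"
    using fps_compose_nth_1[OF assms(2), of h] assms(3) by simp
  then have Z1: "Z $ 1 \<noteq> 0" by auto
  have inv0: "fps_inv Z $ 0 = 0" by (simp add: fps_inv_def)
  have "h = h oo (Z oo fps_inv Z)"
    by (simp add: fps_inv_right[OF assms(2) Z1])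
  also have "\<dots> = (h oo Z) oo fps_inv Z"
    using inv0 assms by (intro fps_compose_assoc)
  also have "\<dots> = fps_inv Z" using inv0 assms by simp
  finally show ?thesis by (simp add: fps_inv_right[OF assms(2) Z1])
qed

lemma fps_deriv_fps_log:
  assumes "F $ 0 = 1"
  shows "fps_deriv (fps_log F) = inverse F * fps_deriv F"
proof -
  have "fps_deriv (fps_log F) = (fps_deriv (fps_ln 1) oo (F - 1)) * fps_deriv (F - 1)"
    unfolding fps_log_def using assms by (intro fps_compose_deriv) simp
  also have "fps_deriv (fps_ln 1) oo (F - 1) = inverse ((1 + fps_X) oo (F - 1))"
    using assms by (simp add: fps_ln_deriv fps_inverse_compose)
  also have "(1 + fps_X) oo (F - 1) = F"
    using assms by (simp add: fps_compose_add_distrib)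
  finally show ?thesis by simp
qed

text \<open>\<open>W\<close> is \<open>fps_X\<close> times a unit and thus divides
  \<open>fps_X * fps_deriv W\<close>, which makes the division exact.\<close>

lemma z_log_deriv_mult_self:
  assumes "W $ 0 = 0" "W $ 1 \<noteq> 0"
  shows "z_log_deriv W * W = fps_X * fps_deriv W"
proof -
  define V where "V = fps_shift 1 W"
  have W: "W = fps_X * V" using assms(1) by (intro fps_ext) (auto simp: V_def)
  have "V * inverse V = 1" using assms(2) by (intro inverse_mult_eq_1') (simp add: V_def)
  then have "fps_X * fps_deriv W = W * (inverse V * fps_deriv W)"
    by (subst (2) W) (simp add: mult.assoc[symmetric])
  then have "W dvd fps_X * fps_deriv W" by (rule dvdI)
  then show ?thesis by (simp add: z_log_deriv_def)
qed

text \<open>Chain rule for the substitution of \<open>h\<close>, with \<open>L\<close> in the role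
  of a resolvent logarithmic derivative. Both sides are compared after multiplication by
  \<open>W\<close>, which is nonzero and can be cancelled.\<close>

lemma z_log_deriv_compose:
  fixes u h M L :: "complex fps"
  assumes u: "u $ 0 = 0" "u $ 1 \<noteq> 0" and h: "h $ 0 = 0" "h $ 1 \<noteq> 0"
    and L: "u * L = - (fps_deriv u * (M oo u))"
  shows "z_log_deriv (u oo h) * (M oo (u oo h)) = - (fps_X * fps_deriv h * (L oo h))"
proof -
  define W where "W = u oo h"
  have W1: "W $ 1 \<noteq> 0"
    unfolding W_def fps_compose_nth_1[OF h(1)] using u h by simp
  have "(u * L) oo h = (- (fps_deriv u * (M oo u))) oo h" by (simp only: L)
  then have L': "W * (L oo h) = - ((fps_deriv u oo h) * (M oo W))"
    by (simp add: W_def fps_compose_mult_distrib[OF h(1)] fps_compose_uminus fps_compose_assoc[OF h(1) u(1)])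
  have "W * (z_log_deriv W * (M oo W)) = z_log_deriv W * W * (M oo W)"
    by (simp only: mult.assoc mult.left_commute)
  also have "z_log_deriv W * W = fps_X * fps_deriv W"
    using W1 u by (intro z_log_deriv_mult_self) (auto simp: W_def)
  also have "fps_deriv W = (fps_deriv u oo h) * fps_deriv h"
    unfolding W_def by (rule fps_compose_deriv[OF h(1)])
  also have "fps_X * ((fps_deriv u oo h) * fps_deriv h) * (M oo W) =
      - (fps_X * fps_deriv h * - ((fps_deriv u oo h) * (M oo W)))"
    by (simp add: algebra_simps)
  also have "\<dots> = W * (- (fps_X * fps_deriv h * (L oo h)))"
    unfolding L'[symmetric] by (simp add: algebra_simps)
  finally have "W * (z_log_deriv W * (M oo W)) = W * (- (fps_X * fps_deriv h * (L oo h)))" .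
  moreover have "W \<noteq> 0" using W1 by auto
  ultimately have "z_log_deriv W * (M oo W) = - (fps_X * fps_deriv h * (L oo h))"
    using mult_left_cancel by blast
  then show ?thesis by (simp only: W_def)
qed

lemma fps_deriv_fps_log_compose:
  assumes "F $ 0 = 1" "h $ 0 = 0"
  shows "fps_deriv (fps_log (F oo h)) = ((inverse F * fps_deriv F) oo h) * fps_deriv h"
proof -
  have "fps_deriv (fps_log (F oo h)) = inverse (F oo h) * fps_deriv (F oo h)"
    using assms by (intro fps_deriv_fps_log) simp
  also have "inverse (F oo h) = inverse F oo h"
    using assms by (simp add: fps_inverse_compose)
  also have "fps_deriv (F oo h) = (fps_deriv F oo h) * fps_deriv h"
    using assms by (intro fps_compose_deriv)
  finally show ?thesis
    by (simp add: fps_compose_mult_distrib[OF assms(2)] mult.assoc)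
qed

lemma fps_log_deriv_divide:
  fixes f g :: "complex fps"
  assumes "f $ 0 = 1" "g $ 0 = 1"
  shows "inverse (f * inverse g) * fps_deriv (f * inverse g) = inverse f * fps_deriv f - inverse g * fps_deriv g"
proof -
  have f: "inverse f * f = 1" and g: "inverse g * g = 1" using assms by (auto intro: inverse_mult_eq_1)
  have dg: "fps_deriv (inverse g) = - fps_deriv g * (inverse g)\<^sup>2"
    using assms by (simp add: fps_inverse_deriv)
  have "inverse (f * inverse g) = inverse f * g"
    using assms by (simp add: fps_inverse_mult)
  then have "inverse (f * inverse g) * fps_deriv (f * inverse g) =
      inverse f * g * (f * (- fps_deriv g * (inverse g)\<^sup>2) + fps_deriv f * inverse g)"
    by (simp add: dg)
  also have "\<dots> = inverse f * fps_deriv f * (inverse g * g)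
      - (inverse f * f) * (inverse g * g) * (inverse g * fps_deriv g)"
    by (simp add: algebra_simps power2_eq_square)
  finally show ?thesis by (simp add: f g)
qed

section \<open>The moment formula for the product\<close>

theorem proposition4p10:
  fixes scale :: "complex \<Rightarrow> 'a::ring_1 \<Rightarrow> 'a"
    and \<psi> \<phi> \<omega> :: "'a \<Rightarrow> complex"
    and x y :: 'a
    and W\<^sub>x W\<^sub>y :: "complex fps"
  assumes "complex_algebra_1 scale"
    and "unital_linear_functional scale \<psi>"
    and "unital_linear_functional scale \<phi>"
    and "tracial_linear_functional scale \<omega>"
    and "cyclically_cond_free scale x y \<psi> \<phi> \<omega>"
    and "\<psi> x \<noteq> 0"
    and "\<psi> y \<noteq> 0"
    and "W\<^sub>x = fps_inv (eta_series \<psi> x) oo eta_series \<psi> (x * y)"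
    and "W\<^sub>y = fps_inv (eta_series \<psi> y) oo eta_series \<psi> (x * y)"
  shows "moment_series \<omega> (x * y) =
      z_log_deriv W\<^sub>x * (moment_series \<omega> x oo W\<^sub>x)
    + z_log_deriv W\<^sub>y * (moment_series \<omega> y oo W\<^sub>y)
    - fps_X * fps_deriv (fps_log
        ((1 - eta_series \<phi> (x * y)) /
         ((1 - (eta_series \<phi> x oo W\<^sub>x)) * (1 - (eta_series \<phi> y oo W\<^sub>y)))))
    - fps_const (1 - \<omega> 1) * (fps_X * fps_deriv (fps_log (1 - eta_series \<psi> (x * y))))"
proof -
  interpret complex_algebra_1 scale by fact
  interpret psi: complex_functional scale \<psi>
    using assms(2) by unfold_locales (auto simp: unital_linear_functional_def)
  interpret phi: complex_functional scale \<phi>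
    using assms(3) by unfold_locales (auto simp: unital_linear_functional_def)
  interpret om: complex_functional scale \<omega>
    using assms(4) by unfold_locales (auto simp: tracial_linear_functional_def)
  have unit: "\<psi> 1 = 1" "\<phi> 1 = 1" using assms(2,3) by (auto simp: unital_linear_functional_def)
  have tr: "\<omega> (a * b) = \<omega> (b * a)" for a b
    using assms(4) by (auto simp: tracial_linear_functional_def)

  define A where "A = unital_subalgebra scale hull {x}"
  define B where "B = unital_subalgebra scale hull {y}"
  define S where "S = {c \<in> A. \<psi> c = 0}"
  define S' where "S' = {c \<in> B. \<psi> c = 0}"
  have A: "unital_subalgebra scale A" "x \<in> A" and B: "unital_subalgebra scale B" "y \<in> B"
    unfolding A_def B_def by (rule unital_subalgebra_hull, rule hull_inc, simp)+
  have subS: "subspace S" "subspace S'"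
    using A(1) B(1) unfolding S_def S'_def unital_subalgebra_def subspace_def
    by (auto simp: psi.theta_simps)
  have free: "cyclically_cond_free_subalgebras A B \<psi> \<phi> \<omega>"
    using assms(5) by (simp add: cyclically_cond_free_def A_def B_def)
  note free' = cyclically_cond_free_subalgebras_commute[OF free]

  have \<phi>word: "\<phi> (prod_list cs) = prod_list (map \<phi> cs)"
    if "list_all2 (\<in>) cs (alternating S S' n) \<or> list_all2 (\<in>) cs (alternating S' S n)" for cs n
    using that alternating_word_values(2)[OF free, of cs n] alternating_word_values(2)[OF free', of cs n]
    by (cases n) (auto simp: unit S_def S'_def)
  \<comment> \<open>The length \<open>2 * Suc n\<close> excludes the empty word, whose value
    \<open>\<omega> 1\<close> need not be 1.\<close>
  have \<omega>word: "\<omega> (prod_list cs) = prod_list (map \<phi> cs)"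
    if "list_all2 (\<in>) cs (alternating S S' (2 * Suc n))" for cs n
    using alternating_word_values(3)[OF free, of cs "2 * Suc n"] that by (simp add: S_def S'_def)
  \<comment> \<open>On nonempty words both sides vanish; put in this multiplicative form, the fact
    lets \<open>\<psi>\<close> and \<open>\<phi>\<close> be treated by the same lemma.\<close>
  have \<psi>word: "\<psi> (prod_list cs) = prod_list (map \<psi> cs)"
    if cs: "list_all2 (\<in>) cs (alternating S S' n) \<or> list_all2 (\<in>) cs (alternating S' S n)" for cs n
  proof (cases n)
    case 0
    then show ?thesis using cs by (auto simp: unit)
  next
    case (Suc m)
    then have "\<psi> (prod_list cs) = 0"
      using cs alternating_word_values(1)[OF free, of cs n] alternating_word_values(1)[OF free', of cs n]
      by (auto simp: S_def S'_def)
    moreover have "prod_list (map \<psi> cs) = 0"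
      using cs Suc by (auto simp: list_all2_Cons2 S_def S'_def)
    ultimately show ?thesis by simp
  qed

  define u where "u = fps_inv (eta_series \<psi> x)"
  define v where "v = fps_inv (eta_series \<psi> y)"
  define h where "h = eta_series \<psi> (x * y)"
  have u0: "u $ 0 = 0" and v0: "v $ 0 = 0" by (simp_all add: u_def v_def fps_inv_def)
  have eta_u: "eta_series \<psi> x oo u = fps_X" and eta_v: "eta_series \<psi> y oo v = fps_X"
    unfolding u_def v_def using assms(6,7) by (auto intro!: fps_inv_right simp: eta_series_nth_1[simplified])
  have u1: "u $ 1 \<noteq> 0"
    using fps_compose_nth_1[OF u0, of "eta_series \<psi> x"] eta_u by auto
  have v1: "v $ 1 \<noteq> 0"
    using fps_compose_nth_1[OF v0, of "eta_series \<psi> y"] eta_v by auto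
  \<comment> \<open>The shift is the exact quotient of \<open>u * v\<close> by
    \<open>fps_X\<close>.\<close>
  define Z where "Z = fps_shift 1 (u * v)"
  have XZ: "fps_X * Z = u * v"
    by (rule fps_ext) (auto simp: Z_def u0)
  have Z0: "Z $ 0 = 0" by (simp add: Z_def u0 v0)

  define p where "p = 1 - fps_scalar u * fps_const x"
  define q where "q = 1 - fps_scalar v * fps_const y"
  define P where "P = 1 - fps_scalar Z * fps_const (x * y)"
  define s where "s = fps_scalar (1 - fps_X)"
  define r where "r = fps_scalar (inverse (1 - fps_X))"
  obtain E a where E: "p * E = 1" "E * p = 1" and sE: "s * E = 1 + fps_X * a" and a: "\<And>n. a $ n \<in> S"
    by (rule centred_resolvent[OF assms(2) A u0 eta_u, folded p_def s_def S_def]) (rule that)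
  obtain F b where F: "q * F = 1" "F * q = 1" and sF: "s * F = 1 + fps_X * b" and b: "\<And>n. b $ n \<in> S'"
    by (rule centred_resolvent[OF assms(2) B v0 eta_v, folded q_def s_def S'_def]) (rule that)
  define T where "T = fps_X * (a * b)"
  obtain R where R: "(1 - T) * R = 1" "R * (1 - T) = 1"
    using fps_two_sided_inverse[of "1 - T"] by (auto simp: T_def)
  \<comment> \<open>The inverse of \<open>P\<close>: the inverses of \<open>p\<close>,
    \<open>1 - T\<close>, \<open>q\<close> and \<open>r\<close> in reverse order.\<close>
  define D where "D = s * (F * (R * E))"
  have P: "P = p * (1 - T) * q * r"
    unfolding P_def p_def q_def r_def T_def
    by (rule resolvent_factorization[OF E[unfolded p_def] F[unfolded q_def] sE[unfolded s_def] sF[unfolded s_def] XZ])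
  have rs: "r * s = 1"
    unfolding r_def s_def fps_scalar_mult[symmetric] by (simp add: inverse_mult_eq_1)
  have cancel: "G * H = 1 \<Longrightarrow> G * (H * K) = K" for G H K :: "'a fps"
    by (simp add: mult.assoc[symmetric])
  have inv1: "(p * (1 - T)) * (R * E) = 1" "(R * E) * (p * (1 - T)) = 1"
    by (simp_all only: mult.assoc cancel[OF R(1)] cancel[OF E(2)] E R)
  have inv2: "(p * (1 - T) * q) * (F * (R * E)) = 1" "(F * (R * E)) * (p * (1 - T) * q) = 1"
    by (simp_all only: mult.assoc cancel[OF F(1)] cancel[OF R(1)] cancel[OF R(2)] cancel[OF E(2)] E F)
  have PD: "P * D = 1"
    unfolding P D_def using inv2(1) by (simp only: mult.assoc cancel[OF rs])
  have sD: "s * D = (1 + fps_X * b) * R * (1 + fps_X * a)"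
  proof -
    \<comment> \<open>\<open>D\<close> already contains one central factor \<open>s\<close>; of the
      two in \<open>s * D\<close>, one goes to \<open>F\<close> and one to \<open>E\<close>.\<close>
    have "s * D = s * F * (R * (s * E))"
      unfolding D_def s_def by (simp only: mult.assoc fps_scalar_commute_left[of R] fps_scalar_commute_left[of F])
    then show ?thesis by (simp only: sE sF mult.assoc)
  qed

  \<comment> \<open>Here \<open>w\<close> is \<open>1 / (1 - fps_X)\<close>; the formal variable is
    \<open>fps_X\<close>.\<close>
  define w :: "complex fps" where "w = inverse (1 - fps_X)"
  have w: "w * (1 - fps_X) = 1" by (simp add: w_def inverse_mult_eq_1)
  have map_D: "fps_map \<theta> D = w * (inverse (1 - fps_X * (fps_map \<theta> a * fps_map \<theta> b)) *
      ((1 + fps_X * fps_map \<theta> a) * (1 + fps_X * fps_map \<theta> b)))"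
    if \<theta>: "linear_functional scale \<theta>"
      and "\<And>n cs. list_all2 (\<in>) cs (alternating S S' n) \<Longrightarrow> \<theta> (prod_list cs) = prod_list (map \<theta> cs)"
      and "\<And>n cs. list_all2 (\<in>) cs (alternating S' S n) \<Longrightarrow> \<theta> (prod_list cs) = prod_list (map \<theta> cs)" for \<theta>
  proof -
    interpret th: complex_functional scale \<theta> using \<theta> by unfold_locales
    have "(1 - fps_X) * fps_map \<theta> D = fps_map \<theta> (s * D)"
      unfolding s_def by (simp only: th.fps_map_scalar_mult)
    also have "\<dots> = inverse (1 - fps_X * (fps_map \<theta> a * fps_map \<theta> b)) *
      ((1 + fps_X * fps_map \<theta> a) * (1 + fps_X * fps_map \<theta> b))"
      unfolding sD using that(2,3) a b R(1)[unfolded T_def]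
      by (intro th.fps_map_alternating_resolvent)
    finally have "w * ((1 - fps_X) * fps_map \<theta> D) = w * \<dots>" by (rule arg_cong)
    then show ?thesis by (simp only: mult.assoc[symmetric] w mult_1_left)
  qed
  have "fps_map \<psi> D = w * (inverse (1 - fps_X * (fps_map \<psi> a * fps_map \<psi> b)) *
      ((1 + fps_X * fps_map \<psi> a) * (1 + fps_X * fps_map \<psi> b)))"
    by (rule map_D[OF psi.lin]) (rule \<psi>word[OF disjI1], assumption, rule \<psi>word[OF disjI2], assumption)
  moreover have "fps_map \<psi> a = 0" "fps_map \<psi> b = 0"
    using a b by (auto intro!: fps_ext simp: S_def S'_def)
  ultimately have "fps_map \<psi> D = w" by simp
  then have "1 + (moment_series \<psi> (x * y) oo Z) = w"
    using psi.fps_map_resolvent[OF Z0 PD[unfolded P_def]] by (simp add: unit)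
  \<comment> \<open>The inverse of \<open>w\<close> is \<open>1 - fps_X\<close>, so substituting
    \<open>h\<close> for the variable later undoes the substitution of \<open>Z\<close>.\<close>
  then have "h oo Z = fps_X"
    using one_minus_eta_compose[OF Z0, of \<psi> "x * y"] by (simp add: h_def w_def)
  have h0: "h $ 0 = 0" by (simp add: h_def)
  have Zh: "Z oo h = fps_X" by (rule fps_compose_inverse_commute[OF h0 Z0]) fact
  have h1: "h $ 1 \<noteq> 0"
    using fps_compose_nth_1[OF h0, of Z] Zh by auto

  define \<alpha> where "\<alpha> = fps_map \<phi> a"
  define \<beta> where "\<beta> = fps_map \<phi> b"
  define \<tau> where "\<tau> = fps_X * (\<alpha> * \<beta>)"
  have \<phi>D: "fps_map \<phi> D = w * (inverse (1 - \<tau>) * ((1 + fps_X * \<alpha>) * (1 + fps_X * \<beta>)))"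
    unfolding \<tau>_def \<alpha>_def \<beta>_def 
    by (rule map_D[OF phi.lin]) (rule \<phi>word[OF disjI1], assumption, rule \<phi>word[OF disjI2], assumption)
  have \<phi>E: "fps_map \<phi> E = w * (1 + fps_X * \<alpha>)" and \<phi>F: "fps_map \<phi> F = w * (1 + fps_X * \<beta>)"
  proof -
    have "(1 - fps_X) * fps_map \<phi> E = fps_map \<phi> (s * E)" "(1 - fps_X) * fps_map \<phi> F = fps_map \<phi> (s * F)"
      unfolding s_def by (simp_all only: phi.fps_map_scalar_mult)
    then have "(1 - fps_X) * fps_map \<phi> E = 1 + fps_X * \<alpha>" "(1 - fps_X) * fps_map \<phi> F = 1 + fps_X * \<beta>"
      by (simp_all add: sE sF phi.fps_map_add phi.fps_map_X_mult phi.fps_map_one unit \<alpha>_def \<beta>_def)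
    then show "fps_map \<phi> E = w * (1 + fps_X * \<alpha>)" "fps_map \<phi> F = w * (1 + fps_X * \<beta>)"
      using w by (metis mult.assoc mult_1_left)+
  qed
  have Nx: "1 - (eta_series \<phi> x oo u) = inverse (fps_map \<phi> E)"
    using one_minus_eta_compose[OF u0, of \<phi> x] phi.fps_map_resolvent[OF u0 E(1)[unfolded p_def]]
    by (simp add: unit)
  have Ny: "1 - (eta_series \<phi> y oo v) = inverse (fps_map \<phi> F)"
    using one_minus_eta_compose[OF v0, of \<phi> y] phi.fps_map_resolvent[OF v0 F(1)[unfolded q_def]]
    by (simp add: unit)
  have Nxy: "1 - (eta_series \<phi> (x * y) oo Z) = inverse (fps_map \<phi> D)"
    using one_minus_eta_compose[OF Z0, of \<phi> "x * y"] phi.fps_map_resolvent[OF Z0 PD[unfolded P_def]]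
    by (simp add: unit)
  \<comment> \<open>The factors \<open>1 + fps_X \<alpha>\<close> and
    \<open>1 + fps_X \<beta>\<close> cancel in the ratio of the values of \<open>\<phi>\<close> on
    the resolvents, and of three factors \<open>w\<close> one survives.\<close>
  define \<rho> where "\<rho> = (1 - \<tau>) * inverse (1 - fps_X)"
  have ratio: "(1 - eta_series \<phi> (x * y)) / ((1 - (eta_series \<phi> x oo W\<^sub>x)) * (1 - (eta_series \<phi> y oo W\<^sub>y))) = \<rho> oo h"
  proof -
    have one_h: "1 - (f oo h) = (1 - f) oo h" for f :: "complex fps"
      by (simp add: fps_compose_sub_distrib)
    have "eta_series \<phi> (x * y) = (eta_series \<phi> (x * y) oo Z) oo h"
      using fps_compose_assoc[OF h0 Z0, of "eta_series \<phi> (x * y)"] Zh by simp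
    then have xy: "1 - eta_series \<phi> (x * y) = inverse (fps_map \<phi> D) oo h"
      by (metis one_h Nxy)
    have x: "1 - (eta_series \<phi> x oo W\<^sub>x) = inverse (fps_map \<phi> E) oo h"
      using fps_compose_assoc[OF h0 u0, of "eta_series \<phi> x"] assms(8)
      by (simp add: u_def[symmetric] h_def[symmetric] one_h Nx)
    have y: "1 - (eta_series \<phi> y oo W\<^sub>y) = inverse (fps_map \<phi> F) oo h"
      using fps_compose_assoc[OF h0 v0, of "eta_series \<phi> y"] assms(9)
      by (simp add: v_def[symmetric] h_def[symmetric] one_h Ny)
    define N where "N = inverse (fps_map \<phi> E) * inverse (fps_map \<phi> F)"
    have N0: "N $ 0 \<noteq> 0" by (simp add: N_def \<phi>E \<phi>F w_def)
    have "\<rho> * N = inverse (fps_map \<phi> D)"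
    proof -
      have "inverse (1 - \<tau>) $ 0 \<noteq> 0" by (simp add: \<tau>_def)
      then show ?thesis
        unfolding N_def \<phi>D \<phi>E \<phi>F \<rho>_def
        by (simp add: fps_inverse_mult w_def[symmetric] \<tau>_def)
          (use w in \<open>simp add: w_def algebra_simps\<close>)
    qed
    then have "inverse (fps_map \<phi> D) * inverse N = \<rho>"
      using inverse_mult_eq_1'[OF N0] by (metis mult.assoc mult_1_right)
    then have "(inverse (fps_map \<phi> D) oo h) * inverse (N oo h) = \<rho> oo h"
      using fps_inverse_compose[OF h0 N0] fps_compose_mult_distrib[OF h0] by metis
    moreover have "(N oo h) $ 0 \<noteq> 0" using N0 by simp
    ultimately show ?thesis
      unfolding xy x y fps_compose_mult_distrib[OF h0, symmetric] N_def[symmetric]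
      by (simp add: fps_divide_unit)
  qed

  define L\<^sub>x where "L\<^sub>x = om.log_deriv p E"
  define L\<^sub>y where "L\<^sub>y = om.log_deriv q F"
  define L where "L = om.log_deriv P D"
  \<comment> \<open>The logarithmic derivative is split along
    \<open>P = p * (1 - T) * q * r\<close>, one factor at a time from the right.\<close>
  have "L = om.log_deriv (p * (1 - T) * q) (F * (R * E)) + om.log_deriv r s"
    unfolding L_def P D_def by (rule om.log_deriv_mult[OF tr inv2 rs])
  also have "om.log_deriv (p * (1 - T) * q) (F * (R * E)) = om.log_deriv (p * (1 - T)) (R * E) + L\<^sub>y"
    unfolding L\<^sub>y_def by (rule om.log_deriv_mult[OF tr inv1 F(1)])
  also have "om.log_deriv (p * (1 - T)) (R * E) = L\<^sub>x + om.log_deriv (1 - T) R"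
    unfolding L\<^sub>x_def by (rule om.log_deriv_mult[OF tr E R(1)])
  also have "om.log_deriv (1 - T) R = - fps_map \<omega> (fps_deriv T * R)"
    by (simp add: om.log_deriv_def om.fps_map_minus)
  also have "fps_map \<omega> (fps_deriv T * R) = inverse (1 - \<tau>) * fps_deriv \<tau>"
    unfolding T_def \<tau>_def \<alpha>_def \<beta>_def
    by (rule om.fps_map_deriv_alternating[OF \<omega>word phi.lin subS a b R(1)[unfolded T_def]])
  also have "om.log_deriv r s = fps_const (\<omega> 1) * w"
  proof -
    have "fps_deriv w * (1 - fps_X) = w * (w * (1 - fps_X))"
      by (simp add: w_def fps_inverse_deriv power2_eq_square)
    then show ?thesis by (simp add: r_def s_def om.log_deriv_scalar w_def[symmetric] w)
  qed
  finally have L: "L = L\<^sub>x + L\<^sub>y - inverse (1 - \<tau>) * fps_deriv \<tau> + fps_const (\<omega> 1) * w" by simp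

  have term_x: "z_log_deriv W\<^sub>x * (moment_series \<omega> x oo W\<^sub>x) = - (fps_X * fps_deriv h * (L\<^sub>x oo h))"
    unfolding assms(8) u_def[symmetric] h_def[symmetric] L\<^sub>x_def p_def
    by (intro z_log_deriv_compose u0 u1 h0 h1 om.log_deriv_resolvent E(1)[unfolded p_def])
  have term_y: "z_log_deriv W\<^sub>y * (moment_series \<omega> y oo W\<^sub>y) = - (fps_X * fps_deriv h * (L\<^sub>y oo h))"
    unfolding assms(9) v_def[symmetric] h_def[symmetric] L\<^sub>y_def q_def
    by (intro z_log_deriv_compose v0 v1 h0 h1 om.log_deriv_resolvent F(1)[unfolded q_def])
  have term_xy: "moment_series \<omega> (x * y) = - (fps_X * fps_deriv h * (L oo h))"
  proof -
    have "Z $ 1 \<noteq> 0"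
      using fps_compose_nth_1[OF h0, of Z] Zh by auto
    then have "z_log_deriv (Z oo h) * (moment_series \<omega> (x * y) oo (Z oo h)) = - (fps_X * fps_deriv h * (L oo h))"
      unfolding L_def P_def
      by (intro z_log_deriv_compose Z0 h0 h1 om.log_deriv_resolvent PD[unfolded P_def])
    \<comment> \<open>As \<open>Z oo h\<close> is \<open>fps_X\<close>, its
      \<open>z_log_deriv\<close> is 1 and the composition on the left is trivial.\<close>
    then show ?thesis by (simp add: Zh z_log_deriv_def)
  qed
  have log_ratio: "fps_deriv (fps_log (\<rho> oo h)) =
      ((w - inverse (1 - \<tau>) * fps_deriv \<tau>) oo h) * fps_deriv h"
  proof -
    have "inverse \<rho> * fps_deriv \<rho> = inverse (1 - \<tau>) * fps_deriv (1 - \<tau>) - w * fps_deriv (1 - fps_X)"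
      unfolding \<rho>_def w_def by (rule fps_log_deriv_divide) (auto simp: \<tau>_def)
    then have "inverse \<rho> * fps_deriv \<rho> = w - inverse (1 - \<tau>) * fps_deriv \<tau>" by simp
    moreover have "\<rho> $ 0 = 1" by (simp add: \<rho>_def \<tau>_def)
    ultimately show ?thesis using fps_deriv_fps_log_compose[OF _ h0, of \<rho>] by simp
  qed
  have log_h: "fps_deriv (fps_log (1 - h)) = - ((w oo h) * fps_deriv h)"
  proof -
    have "1 - h = (1 - fps_X) oo h" by (simp add: fps_compose_sub_distrib h0)
    then show ?thesis
      using fps_deriv_fps_log_compose[OF _ h0, of "1 - fps_X"] by (simp add: w_def fps_compose_uminus)
  qed
  \<comment> \<open>The multiples of \<open>w oo h\<close> match: the ratio contributes -1 and the
    last logarithm \<open>1 - \<omega> 1\<close>, together \<open>- \<omega> 1\<close> as in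
    \<open>L\<close>.\<close>
  show ?thesis
    unfolding term_xy term_x term_y ratio log_ratio h_def[symmetric] log_h L
    by (simp add: fps_compose_add_distrib fps_compose_sub_distrib fps_compose_mult_distrib[OF h0]
        fps_const_sub[symmetric] algebra_simps del: fps_const_sub)
qed

end
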